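(* Let $\Sigma$ be a set. The local state classifier of the topos $\Sigma\text{-}\mathbf{Set}_{\mathrm{o.f.}}$ of orbitwise finite $\Sigma$-sets is given by $$F_{\mathrm{o.f.}}=\{{\sim}\text{ a right congruence on }\Sigma^{\ast}\mid \#(\Sigma^{\ast}/{\sim})<\infty\},$$ with the $\Sigma$-action $u\mathrel{({\sim}*w)}v\iff wu\sim wv$, equipped with the morphisms $\{\xi_{(Q,\delta)}\colon(Q,\delta)\to F_{\mathrm{o.f.}}\}_{(Q,\delta)\in\mathrm{ob}(\Sigma\text{-}\mathbf{Set}_{\mathrm{o.f.}})}$ defined, for $q\in Q$ and $u,v\in\Sigma^{\ast}$, by $$u\mathrel{(\xi_{(Q,\delta)}(q))}v\iff q\cdot u=q\cdot v.$$
   Context: $\Sigma^{\ast}$ is the free monoid on the set (alphabet) $\Sigma$. A $\Sigma$-set is a pair $(Q,\delta)$ of a set $Q$ and a function $\delta\colon Q\times\Sigma\to Q$, equivalently a set with a right $\Sigma^{\ast}$-action, written $q\cdot w$; morphisms are equivariant maps. A $\Sigma$-set is orbitwise finite if for each $q\in Q$ the orbit $\{q\cdot w\mid w\in\Sigma^{\ast}\}$ is finite; $\Sigma\text{-}\mathbf{Set}_{\mathrm{o.f.}}$ is the full subcategory of orbitwise finite $\Sigma$-sets. A right congruence on $\Sigma^{\ast}$ is an equivalence relation $\sim$ with $u\sim v\implies uw\sim vw$ for all $u,v,w\in\Sigma^{\ast}$. Local state classifier: for a category $\mathcal{E}$, let $\mathcal{E}_{\mathrm{mono}}$ be the category with the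 same objects and with the monomorphisms of $\mathcal{E}$ as morphisms. The local state classifier of $\mathcal{E}$ is the (possibly large) colimit of the inclusion functor $\mathcal{E}_{\mathrm{mono}}\to\mathcal{E}$, i.e. an object $\Xi$ with a family $\{\xi_X\colon X\to\Xi\}_{X\in\mathrm{ob}(\mathcal{E})}$ such that $\xi_Y\circ m=\xi_X$ for every monomorphism $m\colon X\rightarrowtail Y$, and which is universal among such families: for every object $L$ and family $\{\phi_X\colon X\to L\}_X$ with $\phi_Y\circ m=\phi_X$ for all monomorphisms $m\colon X\rightarrowtail Y$, there is a unique $u\colon\Xi\to L$ with $u\circ\xi_X=\phi_X$ for all $X$. *)

theory Defs
  imports Main "HOL-Library.FuncSet"
begin

section \<open>Categories and local state classifiers\<close>

text \<open>
  \<open>Comp C X Y Z g f\<close> is the composite of \<open>f : X \<rightarrow> Y\<close> and \<open>g : Y \<rightarrow> Z\<close>.  Hom-sets need not be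
  disjoint, so every notion below mentions the objects between which an arrow is considered.
\<close>

record ('o, 'm) cat =
  Ob :: "'o set"
  Hom :: "'o \<Rightarrow> 'o \<Rightarrow> 'm set"
  Id :: "'o \<Rightarrow> 'm"
  Comp :: "'o \<Rightarrow> 'o \<Rightarrow> 'o \<Rightarrow> 'm \<Rightarrow> 'm \<Rightarrow> 'm"

definition category :: "('o, 'm) cat \<Rightarrow> bool" where
  "category C \<longleftrightarrow>
     (\<forall>X\<in>Ob C. Id C X \<in> Hom C X X) \<and>
     (\<forall>X\<in>Ob C. \<forall>Y\<in>Ob C. \<forall>Z\<in>Ob C. \<forall>f\<in>Hom C X Y. \<forall>g\<in>Hom C Y Z. Comp C X Y Z g f \<in> Hom C X Z) \<and>
     (\<forall>X\<in>Ob C. \<forall>Y\<in>Ob C. \<forall>f\<in>Hom C X Y.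
        Comp C X X Y f (Id C X) = f \<and> Comp C X Y Y (Id C Y) f = f) \<and>
     (\<forall>W\<in>Ob C. \<forall>X\<in>Ob C. \<forall>Y\<in>Ob C. \<forall>Z\<in>Ob C. \<forall>f\<in>Hom C W X. \<forall>g\<in>Hom C X Y. \<forall>h\<in>Hom C Y Z.
        Comp C W X Z (Comp C X Y Z h g) f = Comp C W Y Z h (Comp C W X Y g f))"

definition full_subcategory :: "('o, 'm) cat \<Rightarrow> ('o \<Rightarrow> bool) \<Rightarrow> ('o, 'm) cat" where
  "full_subcategory C P = C\<lparr>Ob := {X \<in> Ob C. P X}\<rparr>"

definition monomorphism :: "('o, 'm) cat \<Rightarrow> 'o \<Rightarrow> 'o \<Rightarrow> 'm \<Rightarrow> bool" where
  "monomorphism C X Y m \<longleftrightarrow> m \<in> Hom C X Y \<and>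
     (\<forall>Z\<in>Ob C. \<forall>f\<in>Hom C Z X. \<forall>g\<in>Hom C Z X. Comp C Z X Y m f = Comp C Z X Y m g \<longrightarrow> f = g)"

text \<open>Cocones under the inclusion of the category of monomorphisms; only the values of \<open>\<phi>\<close> on
  \<open>Ob C\<close> are relevant.\<close>

definition mono_cocone :: "('o, 'm) cat \<Rightarrow> 'o \<Rightarrow> ('o \<Rightarrow> 'm) \<Rightarrow> bool" where
  "mono_cocone C L \<phi> \<longleftrightarrow> L \<in> Ob C \<and> (\<forall>X\<in>Ob C. \<phi> X \<in> Hom C X L) \<and>
     (\<forall>X\<in>Ob C. \<forall>Y\<in>Ob C. \<forall>m. monomorphism C X Y m \<longrightarrow> Comp C X Y L (\<phi> Y) m = \<phi> X)"

definition local_state_classifier :: "('o, 'm) cat \<Rightarrow> 'o \<Rightarrow> ('o \<Rightarrow> 'm) \<Rightarrow> bool" where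
  "local_state_classifier C \<Xi> \<xi> \<longleftrightarrow> mono_cocone C \<Xi> \<xi> \<and>
     (\<forall>L \<phi>. mono_cocone C L \<phi> \<longrightarrow>
        (\<exists>!u. u \<in> Hom C \<Xi> L \<and> (\<forall>X\<in>Ob C. Comp C X \<Xi> L u (\<xi> X) = \<phi> X)))"


section \<open>Sets with an action of a free monoid\<close>

text \<open>
  The alphabet \<open>\<Sigma>\<close> is an arbitrary, possibly empty, set, and the free monoid on it is
  \<^term>\<open>lists \<Sigma>\<close>.  Transition functions and morphisms are extensional, so that equality in HOL
  is equality of functions on the carriers.
\<close>

type_synonym ('q, 's) sset = "'q set \<times> ('q \<times> 's \<Rightarrow> 'q)"

abbreviation states :: "('q, 's) sset \<Rightarrow> 'q set" where "states \<equiv> fst"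
abbreviation trans_fun :: "('q, 's) sset \<Rightarrow> 'q \<times> 's \<Rightarrow> 'q" where "trans_fun \<equiv> snd"

definition is_sset :: "'s set \<Rightarrow> ('q, 's) sset \<Rightarrow> bool" where
  "is_sset \<Sigma> X \<longleftrightarrow> trans_fun X \<in> states X \<times> \<Sigma> \<rightarrow>\<^sub>E states X"

definition act :: "('q, 's) sset \<Rightarrow> 'q \<Rightarrow> 's list \<Rightarrow> 'q" where
  "act X q w = foldl (\<lambda>p a. trans_fun X (p, a)) q w"

definition orbitwise_finite :: "'s set \<Rightarrow> ('q, 's) sset \<Rightarrow> bool" where
  "orbitwise_finite \<Sigma> X \<longleftrightarrow> (\<forall>q\<in>states X. finite {act X q w |w. w \<in> lists \<Sigma>})"

definition equivariant_maps ::
    "'s set \<Rightarrow> ('p, 's) sset \<Rightarrow> ('q, 's) sset \<Rightarrow> ('p \<Rightarrow> 'q) set" where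
  "equivariant_maps \<Sigma> X Y =
     {f \<in> states X \<rightarrow>\<^sub>E states Y. \<forall>q\<in>states X. \<forall>w\<in>lists \<Sigma>. f (act X q w) = act Y (f q) w}"

text \<open>
  HOL has no type of all sets.  The category of sets is therefore taken relative to a collection
  \<open>\<U>\<close> of subsets of a type \<open>'u\<close>, the sets that count as small: for instance all subsets of \<open>'u\<close>,
  or, when \<open>'u\<close> is a model of set theory, the extensions of its elements.
\<close>

definition SSet :: "'u set set \<Rightarrow> 's set \<Rightarrow> (('u, 's) sset, 'u \<Rightarrow> 'u) cat" where
  "SSet \<U> \<Sigma> =
     \<lparr>Ob = {X. states X \<in> \<U> \<and> is_sset \<Sigma> X},
      Hom = equivariant_maps \<Sigma>,
      Id = (\<lambda>X. \<lambda>q\<in>states X. q),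
      Comp = (\<lambda>X Y Z g f. compose (states X) g f)\<rparr>"

definition SSet_of :: "'u set set \<Rightarrow> 's set \<Rightarrow> (('u, 's) sset, 'u \<Rightarrow> 'u) cat" where
  "SSet_of \<U> \<Sigma> = full_subcategory (SSet \<U> \<Sigma>) (orbitwise_finite \<Sigma>)"

text \<open>The isomorphic copy of a \<open>\<Sigma>\<close>-set along a map \<open>e\<close> that is injective on its states.\<close>

definition transport :: "'s set \<Rightarrow> ('p \<Rightarrow> 'q) \<Rightarrow> ('p, 's) sset \<Rightarrow> ('q, 's) sset" where
  "transport \<Sigma> e X =
     (e ` states X,
      \<lambda>(x, a)\<in>(e ` states X) \<times> \<Sigma>. e (trans_fun X (the_inv_into (states X) e x, a)))"


section \<open>Right congruences of finite index\<close>

definition right_congruence :: "'s set \<Rightarrow> 's list rel \<Rightarrow> bool" where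
  "right_congruence \<Sigma> r \<longleftrightarrow> equiv (lists \<Sigma>) r \<and>
     (\<forall>u\<in>lists \<Sigma>. \<forall>v\<in>lists \<Sigma>. \<forall>w\<in>lists \<Sigma>. (u, v) \<in> r \<longrightarrow> (u @ w, v @ w) \<in> r)"

definition congruence_act :: "'s set \<Rightarrow> 's list rel \<Rightarrow> 's list \<Rightarrow> 's list rel" where
  "congruence_act \<Sigma> r w = {(u, v). u \<in> lists \<Sigma> \<and> v \<in> lists \<Sigma> \<and> (w @ u, w @ v) \<in> r}"

definition F_of_states :: "'s set \<Rightarrow> 's list rel set" where
  "F_of_states \<Sigma> = {r. right_congruence \<Sigma> r \<and> finite (lists \<Sigma> // r)}"

definition F_of :: "'s set \<Rightarrow> ('s list rel, 's) sset" where
  "F_of \<Sigma> = (F_of_states \<Sigma>, \<lambda>(r, a)\<in>F_of_states \<Sigma> \<times> \<Sigma>. congruence_act \<Sigma> r [a])"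

definition xi :: "'s set \<Rightarrow> ('q, 's) sset \<Rightarrow> 'q \<Rightarrow> 's list rel" where
  "xi \<Sigma> X = (\<lambda>q\<in>states X. {(u, v). u \<in> lists \<Sigma> \<and> v \<in> lists \<Sigma> \<and> act X q u = act X q v})"


section \<open>Consistency of the definitions\<close>

lemma act_Nil [simp]: "act X q [] = q"
  by (simp add: act_def)

lemma act_Cons [simp]: "act X q (a # w) = act X (trans_fun X (q, a)) w"
  by (simp add: act_def)

lemma act_in_states:
  assumes "is_sset \<Sigma> X" "w \<in> lists \<Sigma>" "q \<in> states X"
  shows "act X q w \<in> states X"
  using assms(2,3)
proof (induction w arbitrary: q)
  case (Cons a w)
  then have "trans_fun X (q, a) \<in> states X"
    using assms(1) by (auto simp: is_sset_def PiE_iff)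
  then show ?case using Cons by simp
qed simp

lemma category_SSet: "category (SSet \<U> \<Sigma>)"
proof -
  have comp: "compose (states X) g f \<in> equivariant_maps \<Sigma> X Z"
    if "is_sset \<Sigma> X" "f \<in> equivariant_maps \<Sigma> X Y" "g \<in> equivariant_maps \<Sigma> Y Z"
    for X Y Z :: "('a, 'b) sset" and f g
    using that act_in_states[OF that(1)]
    by (auto simp: equivariant_maps_def compose_def PiE_iff simp del: in_lists_conv_set)
  have id: "(\<lambda>q\<in>states X. q) \<in> equivariant_maps \<Sigma> X X"
    if "is_sset \<Sigma> X" for X :: "('a, 'b) sset"
    using act_in_states[OF that] by (auto simp: equivariant_maps_def simp del: in_lists_conv_set)
  have unit: "compose (states X) f (\<lambda>q\<in>states X. q) = f"
    "compose (states X) (\<lambda>q\<in>states Y. q) f = f"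
    if "f \<in> equivariant_maps \<Sigma> X Y" for X Y :: "('a, 'b) sset" and f
    using that by (auto simp: equivariant_maps_def compose_def PiE_iff extensional_def fun_eq_iff)
  have assoc: "compose (states W) (compose (states X) h g) f = compose (states W) h (compose (states W) g f)"
    if "f \<in> equivariant_maps \<Sigma> W X" for W X :: "('a, 'b) sset" and f g h
    using that by (auto simp: equivariant_maps_def compose_def PiE_iff fun_eq_iff)
  show ?thesis
    unfolding category_def SSet_def by (auto intro: comp id unit assoc simp del: split_paired_All)
qed

lemma category_full_subcategory: "category C \<Longrightarrow> category (full_subcategory C P)"
  unfolding category_def full_subcategory_def by simp

lemma category_SSet_of: "category (SSet_of \<U> \<Sigma>)"
  unfolding SSet_of_def by (rule category_full_subcategory[OF category_SSet])

lemma right_congruence_congruence_act: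
  assumes r: "right_congruence \<Sigma> r" and w: "w \<in> lists \<Sigma>"
  shows "right_congruence \<Sigma> (congruence_act \<Sigma> r w)"
proof -
  have eq: "equiv (lists \<Sigma>) r"
    and cong: "\<And>u v x. u \<in> lists \<Sigma> \<Longrightarrow> v \<in> lists \<Sigma> \<Longrightarrow> x \<in> lists \<Sigma> \<Longrightarrow> (u, v) \<in> r \<Longrightarrow> (u @ x, v @ x) \<in> r"
    using r by (auto simp: right_congruence_def)
  have "equiv (lists \<Sigma>) (congruence_act \<Sigma> r w)"
  proof (rule equivI)
    show "congruence_act \<Sigma> r w \<subseteq> lists \<Sigma> \<times> lists \<Sigma>"
      by (auto simp: congruence_act_def)
    show "refl_on (lists \<Sigma>) (congruence_act \<Sigma> r w)"
      using eq w by (auto simp: congruence_act_def equiv_def refl_on_def)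
    show "sym (congruence_act \<Sigma> r w)"
      using eq by (auto simp: congruence_act_def equiv_def sym_def)
    show "trans (congruence_act \<Sigma> r w)"
      using eq unfolding congruence_act_def equiv_def trans_def by blast
  qed
  moreover have "(u @ x, v @ x) \<in> congruence_act \<Sigma> r w"
    if "u \<in> lists \<Sigma>" "v \<in> lists \<Sigma>" "x \<in> lists \<Sigma>" "(u, v) \<in> congruence_act \<Sigma> r w" for u v x
    using cong[of "w @ u" "w @ v" x] that w by (auto simp: congruence_act_def)
  ultimately show ?thesis by (auto simp: right_congruence_def)
qed

lemma finite_index_congruence_act:
  assumes r: "right_congruence \<Sigma> r" and w: "w \<in> lists \<Sigma>" and fin: "finite (lists \<Sigma> // r)"
  shows "finite (lists \<Sigma> // congruence_act \<Sigma> r w)"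
proof -
  have eq: "equiv (lists \<Sigma>) r" using r by (simp add: right_congruence_def)
  have "lists \<Sigma> // congruence_act \<Sigma> r w \<subseteq> (\<lambda>c. {v \<in> lists \<Sigma>. w @ v \<in> c}) ` (lists \<Sigma> // r)"
  proof
    fix c assume "c \<in> lists \<Sigma> // congruence_act \<Sigma> r w"
    then obtain u where u: "u \<in> lists \<Sigma>" "c = congruence_act \<Sigma> r w `` {u}"
      by (rule quotientE)
    then have "c = {v \<in> lists \<Sigma>. w @ v \<in> r `` {w @ u}}"
      by (auto simp: congruence_act_def)
    moreover have "r `` {w @ u} \<in> lists \<Sigma> // r"
      by (rule quotientI) (use u w in auto)
    ultimately show "c \<in> (\<lambda>c. {v \<in> lists \<Sigma>. w @ v \<in> c}) ` (lists \<Sigma> // r)" by blast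
  qed
  then show ?thesis using fin finite_surj by blast
qed

lemma is_sset_F_of: "is_sset \<Sigma> (F_of \<Sigma>)"
  by (auto simp: is_sset_def F_of_def F_of_states_def
      intro!: right_congruence_congruence_act finite_index_congruence_act)

text \<open>The word action of \<^term>\<open>F_of \<Sigma>\<close> is \<^term>\<open>congruence_act \<Sigma>\<close> on all words, not just letters.\<close>

lemma act_F_of:
  assumes "r \<in> F_of_states \<Sigma>" "w \<in> lists \<Sigma>"
  shows "act (F_of \<Sigma>) r w = congruence_act \<Sigma> r w"
  using assms(2,1)
proof (induction w arbitrary: r)
  case Nil
  then have "r \<subseteq> lists \<Sigma> \<times> lists \<Sigma>"
    by (auto simp: F_of_states_def right_congruence_def equiv_def)
  then show ?case by (auto simp: congruence_act_def)
next
  case (Cons a w)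
  have step: "trans_fun (F_of \<Sigma>) (r, a) = congruence_act \<Sigma> r [a]"
    using Cons by (simp add: F_of_def)
  moreover have "congruence_act \<Sigma> r [a] \<in> F_of_states \<Sigma>"
    using Cons by (auto simp: F_of_states_def
        intro!: right_congruence_congruence_act finite_index_congruence_act)
  moreover have "congruence_act \<Sigma> (congruence_act \<Sigma> r [a]) w = congruence_act \<Sigma> r (a # w)"
    using Cons by (auto simp: congruence_act_def)
  ultimately show ?case using Cons by simp
qed

end

theory Submission
  imports Defs
begin

text \<open>
  Every right congruence \<open>r\<close> of finite index is the kernel of the generator of a cyclic object
  \<open>\<Sigma>\<^sup>*/r\<close>, and a state \<open>q\<close> of \<open>X\<close> with kernel \<open>r\<close> is the image of this generator under an
  injective map \<open>\<Sigma>\<^sup>*/r \<rightarrow> X\<close>.  Hence a cocone is determined by its values at the generators of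
  the cyclic objects, and these values are what the comparison map has to send \<open>r\<close> to.

  The collection \<open>\<U>\<close> need not be closed under products, so kernel pairs are not
  available to show that monomorphisms are injective.  A pair of states identified by a
  monomorphism is instead tested on the cyclic object for the intersection of their kernels.
  That the cyclic objects are small follows from smallness of \<open>F_of \<Sigma>\<close> alone: unless \<open>\<Sigma>\<close> is empty,
  the congruences ``equal length modulo \<open>n\<close>'' make \<open>F_of \<Sigma>\<close> infinite.
\<close>

section \<open>Actions, kernels and equivariant maps\<close>

lemma act_append: "act X q (u @ v) = act X (act X q u) v"
  by (simp add: act_def)

lemma F_of_states_equiv: "r \<in> F_of_states \<Sigma> \<Longrightarrow> equiv (lists \<Sigma>) r"
  by (simp add: F_of_states_def right_congruence_def)

lemma F_of_states_append:
  assumes "r \<in> F_of_states \<Sigma>" "(u, v) \<in> r" "w \<in> lists \<Sigma>"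
  shows "(u @ w, v @ w) \<in> r"
  using assms equiv_type[OF F_of_states_equiv[OF assms(1)]]
  unfolding F_of_states_def right_congruence_def by blast

lemma states_F_of [simp]: "states (F_of \<Sigma>) = F_of_states \<Sigma>"
  by (simp add: F_of_def)

lemma xi_apply:
  "q \<in> states X \<Longrightarrow>
    xi \<Sigma> X q = {(u, v). u \<in> lists \<Sigma> \<and> v \<in> lists \<Sigma> \<and> act X q u = act X q v}"
  by (simp add: xi_def)

text \<open>The class of \<open>u\<close> is the set of words leading from \<open>q\<close> to
  \<open>act X q u\<close>, so there are at most as many classes as points in the orbit of
  \<open>q\<close>.\<close>

lemma xi_in_F_of_states:
  assumes X: "is_sset \<Sigma> X" "orbitwise_finite \<Sigma> X" and q: "q \<in> states X"
  shows "xi \<Sigma> X q \<in> F_of_states \<Sigma>"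
proof -
  let ?r = "xi \<Sigma> X q"
  have "equiv (lists \<Sigma>) ?r"
    by (rule equivI) (auto simp: xi_apply[OF q] refl_on_def sym_def trans_def)
  then have "right_congruence \<Sigma> ?r"
    by (auto simp: right_congruence_def xi_apply[OF q] act_append)
  moreover have "lists \<Sigma> // ?r \<subseteq>
      (\<lambda>p. {v \<in> lists \<Sigma>. p = act X q v}) ` {act X q w |w. w \<in> lists \<Sigma>}"
    by (auto simp: quotient_def xi_apply[OF q])
  moreover have "finite {act X q w |w. w \<in> lists \<Sigma>}"
    using X(2) q by (simp add: orbitwise_finite_def)
  ultimately show ?thesis
    using finite_surj by (auto simp: F_of_states_def)
qed

text \<open>Together with \<open>act_F_of\<close> this makes \<open>xi\<close> equivariant; it rests
  on (q.w).u = q.(wu).\<close>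

lemma xi_act:
  assumes "is_sset \<Sigma> X" "q \<in> states X" "w \<in> lists \<Sigma>"
  shows "xi \<Sigma> X (act X q w) = congruence_act \<Sigma> (xi \<Sigma> X q) w"
  using assms act_in_states[OF assms(1,3,2)]
  by (auto simp: xi_apply congruence_act_def act_append)

text \<open>An injective equivariant map neither creates nor destroys coincidences q.u = q.v. This
  becomes the cocone condition once monomorphisms are known to be injective.\<close>

lemma xi_injective_map:
  assumes "f \<in> equivariant_maps \<Sigma> X Y" "inj_on f (states X)" "is_sset \<Sigma> X" "q \<in> states X"
  shows "xi \<Sigma> Y (f q) = xi \<Sigma> X q"
proof -
  have fq: "f q \<in> states Y" using assms by (auto simp: equivariant_maps_def)
  have "act Y (f q) u = act Y (f q) v \<longleftrightarrow> act X q u = act X q v"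
    if "u \<in> lists \<Sigma>" "v \<in> lists \<Sigma>" for u v
  proof -
    have "act Y (f q) u = f (act X q u)" "act Y (f q) v = f (act X q v)"
      using assms(1,4) that by (simp_all add: equivariant_maps_def)
    then show ?thesis
      using inj_on_eq_iff[OF assms(2)] act_in_states[OF assms(3) that(1) assms(4)]
        act_in_states[OF assms(3) that(2) assms(4)] by simp
  qed
  then show ?thesis by (auto simp: xi_apply assms(4) fq simp del: in_lists_conv_set)
qed

lemma congruence_act_in_F_of_states:
  "r \<in> F_of_states \<Sigma> \<Longrightarrow> w \<in> lists \<Sigma> \<Longrightarrow> congruence_act \<Sigma> r w \<in> F_of_states \<Sigma>"
  by (auto simp: F_of_states_def
      intro!: right_congruence_congruence_act finite_index_congruence_act)

text \<open>The translate of \<open>r\<close> by \<open>w\<close> depends only on the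
  \<open>r\<close>-class of \<open>w\<close>, so finite index of \<open>r\<close> bounds its
  orbit.\<close>

lemma finite_orbit_F_of:
  assumes r: "r \<in> F_of_states \<Sigma>"
  shows "finite {congruence_act \<Sigma> r w |w. w \<in> lists \<Sigma>}"
proof -
  have eq: "equiv (lists \<Sigma>) r" by (rule F_of_states_equiv[OF r])
  \<comment> \<open>\<open>?G\<close> reads the translate off the class of \<open>w\<close>; asking
    for some member of the class avoids choosing a representative.\<close>
  let ?G = "\<lambda>c. {(u, v). u \<in> lists \<Sigma> \<and> v \<in> lists \<Sigma> \<and> (\<exists>w\<in>c. (w @ u, w @ v) \<in> r)}"
  have "congruence_act \<Sigma> r w = ?G (r `` {w})" if w: "w \<in> lists \<Sigma>" for w
  proof -
    \<comment> \<open>Any other member \<open>x\<close> of the class gives the same condition: wu ~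
      xu ~ xv ~ wv, the outer relations by right congruence.\<close>
    have "(w @ u, w @ v) \<in> r"
      if "(w, x) \<in> r" "(x @ u, x @ v) \<in> r" "u \<in> lists \<Sigma>" "v \<in> lists \<Sigma>" for x u v
    proof -
      have "(w @ u, x @ u) \<in> r" "(w @ v, x @ v) \<in> r"
        using F_of_states_append[OF r] that by blast+
      moreover have "sym r" "trans r" using eq by (simp_all add: equiv_def)
      ultimately show ?thesis using that(2) by (metis symD transD)
    qed
    moreover have "(w, w) \<in> r" using eq w by (simp add: equiv_def refl_on_def)
    ultimately show ?thesis unfolding congruence_act_def by blast
  qed
  then have "congruence_act \<Sigma> r w \<in> ?G ` (lists \<Sigma> // r)" if "w \<in> lists \<Sigma>" for w
    using quotientI[OF that] that by (intro image_eqI)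
  then have sub: "{congruence_act \<Sigma> r w |w. w \<in> lists \<Sigma>} \<subseteq> ?G ` (lists \<Sigma> // r)" by blast
  show ?thesis by (rule finite_surj[OF _ sub]) (use r in \<open>simp add: F_of_states_def\<close>)
qed

lemma orbitwise_finite_F_of: "orbitwise_finite \<Sigma> (F_of \<Sigma>)"
  unfolding orbitwise_finite_def
proof
  fix r assume "r \<in> states (F_of \<Sigma>)"
  then have r: "r \<in> F_of_states \<Sigma>" by simp
  have "{act (F_of \<Sigma>) r w |w. w \<in> lists \<Sigma>} = {congruence_act \<Sigma> r w |w. w \<in> lists \<Sigma>}"
    using act_F_of[OF r] by metis
  then show "finite {act (F_of \<Sigma>) r w |w. w \<in> lists \<Sigma>}" using finite_orbit_F_of[OF r] by simp
qed

section \<open>Transport\<close>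

lemma states_transport [simp]: "states (transport \<Sigma> e X) = e ` states X"
  by (simp add: transport_def)

lemma is_sset_transport:
  assumes "inj_on e (states X)" "is_sset \<Sigma> X"
  shows "is_sset \<Sigma> (transport \<Sigma> e X)"
  using assms by (auto simp: is_sset_def transport_def the_inv_into_f_f PiE_iff)

lemma act_transport:
  assumes "inj_on e (states X)" "is_sset \<Sigma> X" "q \<in> states X" "w \<in> lists \<Sigma>"
  shows "act (transport \<Sigma> e X) (e q) w = e (act X q w)"
  using assms(4,3)
proof (induction w arbitrary: q)
  case (Cons a w)
  then have "trans_fun X (q, a) \<in> states X"
    using assms(2) by (auto simp: is_sset_def PiE_iff)
  moreover have "trans_fun (transport \<Sigma> e X) (e q, a) = e (trans_fun X (q, a))"
    using Cons assms(1) by (simp add: transport_def the_inv_into_f_f)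
  ultimately show ?case using Cons by simp
qed simp

lemma orbitwise_finite_transport:
  assumes "inj_on e (states X)" "is_sset \<Sigma> X" "orbitwise_finite \<Sigma> X"
  shows "orbitwise_finite \<Sigma> (transport \<Sigma> e X)"
  unfolding orbitwise_finite_def states_transport
proof
  fix x assume "x \<in> e ` states X"
  then obtain q where q: "q \<in> states X" "x = e q" by blast
  have "{act (transport \<Sigma> e X) x w |w. w \<in> lists \<Sigma>} = e ` {act X q w |w. w \<in> lists \<Sigma>}"
    unfolding q(2) image_Collect using act_transport[OF assms(1,2) q(1)] by metis
  then show "finite {act (transport \<Sigma> e X) x w |w. w \<in> lists \<Sigma>}"
    using assms(3) q by (auto simp: orbitwise_finite_def)
qed

section \<open>Cyclic objects\<close>

text \<open>A quotient \<open>\<Sigma>\<^sup>*/r\<close> is presented by a map \<open>h\<close> on words whose kernel is \<open>r\<close>.\<close>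

definition kernel_is :: "'s set \<Rightarrow> ('s list \<Rightarrow> 'q) \<Rightarrow> 's list rel \<Rightarrow> bool" where
  "kernel_is \<Sigma> h r \<longleftrightarrow> (\<forall>u\<in>lists \<Sigma>. \<forall>v\<in>lists \<Sigma>. h u = h v \<longleftrightarrow> (u, v) \<in> r)"

text \<open>The states are values of \<open>h\<close> instead of equivalence classes, so that a
  suitable \<open>h\<close> places the quotient on a small subset of \<open>'u\<close>. A letter
  acts by being appended to an arbitrarily chosen preimage; independence of that choice requires the
  kernel to be a right congruence.\<close>

definition cyclic_sset :: "'s set \<Rightarrow> ('s list \<Rightarrow> 'q) \<Rightarrow> ('q, 's) sset" where
  "cyclic_sset \<Sigma> h =
     (h ` lists \<Sigma>, \<lambda>(z, a)\<in>(h ` lists \<Sigma>) \<times> \<Sigma>. h (inv_into (lists \<Sigma>) h z @ [a]))"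

lemma states_cyclic [simp]: "states (cyclic_sset \<Sigma> h) = h ` lists \<Sigma>"
  by (simp add: cyclic_sset_def)

lemma is_sset_cyclic: "is_sset \<Sigma> (cyclic_sset \<Sigma> h)"
proof -
  have "h (inv_into (lists \<Sigma>) h z @ [a]) \<in> h ` lists \<Sigma>" if "z \<in> h ` lists \<Sigma>" "a \<in> \<Sigma>" for z a
    using inv_into_into[OF that(1)] that(2) by simp
  then show ?thesis by (auto simp: is_sset_def cyclic_sset_def simp del: in_lists_conv_set)
qed

lemma kernel_inv_into:
  assumes "kernel_is \<Sigma> h r" "u \<in> lists \<Sigma>"
  shows "inv_into (lists \<Sigma>) h (h u) \<in> lists \<Sigma>" "(inv_into (lists \<Sigma>) h (h u), u) \<in> r"
proof -
  show *: "inv_into (lists \<Sigma>) h (h u) \<in> lists \<Sigma>"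
    by (rule inv_into_into) (use assms(2) in blast)
  have "h (inv_into (lists \<Sigma>) h (h u)) = h u"
    by (rule f_inv_into_f) (use assms(2) in blast)
  then show "(inv_into (lists \<Sigma>) h (h u), u) \<in> r"
    using assms * unfolding kernel_is_def by blast
qed

text \<open>The preimage chosen for \<open>h u\<close> is \<open>r\<close>-related to
  \<open>u\<close>, and stays so after a letter is appended to both.\<close>

lemma act_cyclic:
  assumes r: "r \<in> F_of_states \<Sigma>" and h: "kernel_is \<Sigma> h r"
    and "u \<in> lists \<Sigma>" "w \<in> lists \<Sigma>"
  shows "act (cyclic_sset \<Sigma> h) (h u) w = h (u @ w)"
  using assms(4,3)
proof (induction w arbitrary: u)
  case (Cons a w)
  note inv = kernel_inv_into[OF h Cons.prems]
  have a: "[a] \<in> lists \<Sigma>" using Cons by simp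
  have "(inv_into (lists \<Sigma>) h (h u) @ [a], u @ [a]) \<in> r"
    by (rule F_of_states_append[OF r inv(2) a])
  moreover have "inv_into (lists \<Sigma>) h (h u) @ [a] \<in> lists \<Sigma>" "u @ [a] \<in> lists \<Sigma>"
    using inv(1) a Cons.prems by simp_all
  ultimately have "h (inv_into (lists \<Sigma>) h (h u) @ [a]) = h (u @ [a])"
    using h unfolding kernel_is_def by blast
  then have "trans_fun (cyclic_sset \<Sigma> h) (h u, a) = h (u @ [a])"
    using Cons by (simp add: cyclic_sset_def del: in_lists_conv_set)
  then show ?case using Cons.IH[of "u @ [a]"] Cons.prems Cons.hyps by simp
qed simp

text \<open>\<open>h\<close> is constant on the classes of \<open>r\<close>, so it factors through
  the finite quotient by evaluation at a chosen member of each class.\<close>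

lemma finite_kernel_image:
  assumes r: "r \<in> F_of_states \<Sigma>" and h: "kernel_is \<Sigma> h r"
  shows "finite (h ` lists \<Sigma>)"
proof -
  have "h u \<in> (\<lambda>c. h (SOME v. v \<in> c)) ` (lists \<Sigma> // r)" if u: "u \<in> lists \<Sigma>" for u
  proof (rule image_eqI)
    have "u \<in> r `` {u}" using equiv_class_self[OF F_of_states_equiv[OF r] u] .
    then have "(SOME v. v \<in> r `` {u}) \<in> r `` {u}" by (rule someI)
    then have "(u, SOME v. v \<in> r `` {u}) \<in> r" by simp
    moreover from this have "(SOME v. v \<in> r `` {u}) \<in> lists \<Sigma>"
      using equiv_type[OF F_of_states_equiv[OF r]] by blast
    ultimately show "h u = h (SOME v. v \<in> r `` {u})"
      using h u unfolding kernel_is_def by blast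
  qed (rule quotientI[OF u])
  then have "h ` lists \<Sigma> \<subseteq> (\<lambda>c. h (SOME v. v \<in> c)) ` (lists \<Sigma> // r)" by blast
  then show ?thesis using r finite_surj by (auto simp: F_of_states_def)
qed

lemma orbitwise_finite_cyclic:
  assumes "r \<in> F_of_states \<Sigma>" "kernel_is \<Sigma> h r"
  shows "orbitwise_finite \<Sigma> (cyclic_sset \<Sigma> h)"
proof -
  have "{act (cyclic_sset \<Sigma> h) q w |w. w \<in> lists \<Sigma>} \<subseteq> h ` lists \<Sigma>"
    if "q \<in> states (cyclic_sset \<Sigma> h)" for q
    using act_in_states[OF is_sset_cyclic _ that] by (auto simp del: in_lists_conv_set)
  then show ?thesis
    using finite_subset[OF _ finite_kernel_image[OF assms]] unfolding orbitwise_finite_def by blast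
qed

text \<open>A word \<open>u\<close> takes the generator \<open>h []\<close> to \<open>h u\<close>.
  Hence every \<open>r\<close> is a value of \<open>xi\<close>, which is what forces uniqueness of
  the comparison map.\<close>

lemma xi_cyclic:
  assumes "r \<in> F_of_states \<Sigma>" "kernel_is \<Sigma> h r"
  shows "xi \<Sigma> (cyclic_sset \<Sigma> h) (h []) = r"
proof -
  have z: "h [] \<in> states (cyclic_sset \<Sigma> h)" by (auto intro!: imageI)
  have act: "act (cyclic_sset \<Sigma> h) (h []) u = h u" if "u \<in> lists \<Sigma>" for u
    using act_cyclic[OF assms _ that, of "[]"] by simp
  have "r \<subseteq> lists \<Sigma> \<times> lists \<Sigma>"
    using equiv_type[OF F_of_states_equiv[OF assms(1)]] .
  moreover have "act (cyclic_sset \<Sigma> h) (h []) u = act (cyclic_sset \<Sigma> h) (h []) v \<longleftrightarrow> (u, v) \<in> r"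
    if "u \<in> lists \<Sigma>" "v \<in> lists \<Sigma>" for u v
    unfolding act[OF that(1)] act[OF that(2)] using assms(2) that unfolding kernel_is_def by blast
  ultimately show ?thesis unfolding xi_apply[OF z] by blast
qed

text \<open>Universal property of the cyclic object: the inclusion \<open>sub\<close> is what makes
  the assignment of q.u to \<open>h u\<close> well defined. The inclusion serves to test
  monomorphisms; in the case of equality the map is moreover injective.\<close>

lemma cyclic_map:
  assumes r: "r \<in> F_of_states \<Sigma>" and h: "kernel_is \<Sigma> h r"
    and X: "is_sset \<Sigma> X" and q: "q \<in> states X" and sub: "r \<subseteq> xi \<Sigma> X q"
  obtains f where "f \<in> equivariant_maps \<Sigma> (cyclic_sset \<Sigma> h) X"
    "\<And>u. u \<in> lists \<Sigma> \<Longrightarrow> f (h u) = act X q u"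
proof
  let ?f = "\<lambda>z\<in>h ` lists \<Sigma>. act X q (inv_into (lists \<Sigma>) h z)"
  show f: "?f (h u) = act X q u" if u: "u \<in> lists \<Sigma>" for u
  proof -
    have "(inv_into (lists \<Sigma>) h (h u), u) \<in> xi \<Sigma> X q"
      using kernel_inv_into(2)[OF h u] sub by blast
    then show ?thesis using u q by (simp add: xi_apply del: in_lists_conv_set)
  qed
  have "?f (h u) \<in> states X" if "u \<in> lists \<Sigma>" for u
    using act_in_states[OF X that q] unfolding f[OF that] .
  then have "?f \<in> h ` lists \<Sigma> \<rightarrow>\<^sub>E states X"
    by (intro PiE_I) (force simp del: in_lists_conv_set)+
  moreover have "?f (act (cyclic_sset \<Sigma> h) (h u) w) = act X (?f (h u)) w"
    if "u \<in> lists \<Sigma>" "w \<in> lists \<Sigma>" for u w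
    unfolding act_cyclic[OF r h that] f[OF that(1)]
    using f[of "u @ w"] that by (simp add: act_append)
  ultimately show "?f \<in> equivariant_maps \<Sigma> (cyclic_sset \<Sigma> h) X"
    unfolding equivariant_maps_def states_cyclic by blast
qed

section \<open>Smallness of the cyclic objects\<close>

definition length_congruence :: "'s set \<Rightarrow> nat \<Rightarrow> 's list rel" where
  "length_congruence \<Sigma> n =
     {(u, v). u \<in> lists \<Sigma> \<and> v \<in> lists \<Sigma> \<and> length u mod n = length v mod n}"

text \<open>There is at most one class per residue. Positivity matters because
  \<open>k mod 0 = k\<close>: modulus 0 would compare the lengths themselves.\<close>

lemma length_congruence_in_F_of_states:
  assumes "n > 0"
  shows "length_congruence \<Sigma> n \<in> F_of_states \<Sigma>"
proof -
  let ?r = "length_congruence \<Sigma> n"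
  have "equiv (lists \<Sigma>) ?r"
    by (rule equivI) (auto simp: length_congruence_def refl_on_def sym_def trans_def)
  then have cong: "right_congruence \<Sigma> ?r"
    unfolding right_congruence_def
    by (auto simp: length_congruence_def intro: mod_add_cong)
  have sub: "lists \<Sigma> // ?r \<subseteq> (\<lambda>k. {v \<in> lists \<Sigma>. k = length v mod n}) ` {..<n}"
  proof
    fix c assume "c \<in> lists \<Sigma> // ?r"
    then obtain u where "u \<in> lists \<Sigma>" "c = ?r `` {u}" by (rule quotientE)
    then have "c = {v \<in> lists \<Sigma>. length u mod n = length v mod n}"
      by (auto simp: length_congruence_def)
    then show "c \<in> (\<lambda>k. {v \<in> lists \<Sigma>. k = length v mod n}) ` {..<n}" using assms by simp
  qed
  have "finite (lists \<Sigma> // ?r)" by (rule finite_surj[OF _ sub]) simp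
  with cong show ?thesis by (simp add: F_of_states_def)
qed

text \<open>The modulus can be recovered: a word of \<open>k\<close> copies of \<open>a\<close> is
  related to the empty word exactly when the modulus divides \<open>k\<close>.\<close>

lemma inj_length_congruence:
  assumes "a \<in> \<Sigma>"
  shows "inj (length_congruence \<Sigma>)"
proof (rule injI)
  fix m n assume eq: "length_congruence \<Sigma> m = length_congruence \<Sigma> n"
  have "(replicate k a, []) \<in> length_congruence \<Sigma> n \<longleftrightarrow> n dvd k" for k n
    using assms by (auto simp: length_congruence_def)
  then show "m = n" using eq by (metis dvd_antisym dvd_refl)
qed

text \<open>Number the finitely many classes of \<open>r\<close> and let the number of a class
  determine a modulus; distinct moduli give distinct length congruences.\<close>

lemma kernel_map_into_F_of_states:
  assumes r: "r \<in> F_of_states \<Sigma>"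
  obtains k where "kernel_is \<Sigma> k r" "k ` lists \<Sigma> \<subseteq> F_of_states \<Sigma>"
proof (cases "\<Sigma> = {}")
  case True
  have "([], []) \<in> r"
    using F_of_states_equiv[OF r] by (auto simp: equiv_def refl_on_def)
  \<comment> \<open>Over the empty alphabet the empty word is the only word, so a constant map has
    kernel \<open>r\<close>; \<open>r\<close> itself is an available value.\<close>
  then have "kernel_is \<Sigma> (\<lambda>_. r) r" using True by (simp add: kernel_is_def)
  then show thesis by (rule that) (use r in auto)
next
  case False
  then obtain a where a: "a \<in> \<Sigma>" by blast
  have "finite (lists \<Sigma> // r)" using r by (simp add: F_of_states_def)
  then obtain i :: "'a list set \<Rightarrow> nat" where i: "inj_on i (lists \<Sigma> // r)"
    using finite_imp_inj_to_nat_seg by blast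
  \<comment> \<open>The successor keeps the modulus positive, hence the congruence of finite
    index.\<close>
  let ?k = "\<lambda>u. length_congruence \<Sigma> (Suc (i (r `` {u})))"
  show thesis
  proof (rule that)
    have "?k u = ?k v \<longleftrightarrow> (u, v) \<in> r" if uv: "u \<in> lists \<Sigma>" "v \<in> lists \<Sigma>" for u v
    proof -
      have "?k u = ?k v \<longleftrightarrow> i (r `` {u}) = i (r `` {v})"
        using inj_eq[OF inj_length_congruence[OF a]] by simp
      also have "\<dots> \<longleftrightarrow> r `` {u} = r `` {v}"
        by (rule inj_on_eq_iff[OF i quotientI[OF uv(1)] quotientI[OF uv(2)]])
      also have "\<dots> \<longleftrightarrow> (u, v) \<in> r"
        using eq_equiv_class_iff[OF F_of_states_equiv[OF r] uv] .
      finally show ?thesis .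
    qed
    then show "kernel_is \<Sigma> ?k r" unfolding kernel_is_def by blast
    show "?k ` lists \<Sigma> \<subseteq> F_of_states \<Sigma>" by (auto intro: length_congruence_in_F_of_states)
  qed
qed

lemma small_kernel_map:
  assumes "\<And>A B. B \<in> \<U> \<Longrightarrow> A \<subseteq> B \<Longrightarrow> A \<in> \<U>"
    and e: "inj_on e (F_of_states \<Sigma>)" and "e ` F_of_states \<Sigma> \<in> \<U>"
    and r: "r \<in> F_of_states \<Sigma>"
  obtains h where "kernel_is \<Sigma> h r" "h ` lists \<Sigma> \<in> \<U>"
proof -
  obtain k where k: "kernel_is \<Sigma> k r" "k ` lists \<Sigma> \<subseteq> F_of_states \<Sigma>"
    using kernel_map_into_F_of_states[OF r] .
  have "kernel_is \<Sigma> (e \<circ> k) r"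
    using k unfolding kernel_is_def o_def
    by (simp add: inj_on_eq_iff[OF e] image_subset_iff del: in_lists_conv_set)
  moreover have "(e \<circ> k) ` lists \<Sigma> \<in> \<U>"
    by (rule assms(1)[OF assms(3)]) (use k(2) in auto)
  ultimately show thesis by (rule that)
qed

section \<open>The category of orbitwise finite sets with an action\<close>

lemma Ob_SSet_of:
  "X \<in> Ob (SSet_of \<U> \<Sigma>) \<longleftrightarrow> states X \<in> \<U> \<and> is_sset \<Sigma> X \<and> orbitwise_finite \<Sigma> X"
  by (auto simp: SSet_of_def SSet_def full_subcategory_def)

lemma Hom_SSet_of [simp]: "Hom (SSet_of \<U> \<Sigma>) = equivariant_maps \<Sigma>"
  by (simp add: SSet_of_def SSet_def full_subcategory_def)

lemma Comp_SSet_of [simp]: "Comp (SSet_of \<U> \<Sigma>) X Y Z g f = compose (states X) g f"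
  by (simp add: SSet_of_def SSet_def full_subcategory_def)

lemma monomorphism_if_inj_on:
  assumes f: "f \<in> equivariant_maps \<Sigma> X Y" and inj: "inj_on f (states X)"
  shows "monomorphism (SSet_of \<U> \<Sigma>) X Y f"
  unfolding monomorphism_def Hom_SSet_of Comp_SSet_of
proof (intro conjI ballI impI f)
  fix Z g g'
  assume g: "g \<in> equivariant_maps \<Sigma> Z X" "g' \<in> equivariant_maps \<Sigma> Z X"
    and eq: "compose (states Z) f g = compose (states Z) f g'"
  show "g = g'"
  proof (rule extensionalityI)
    show "g \<in> extensional (states Z)" "g' \<in> extensional (states Z)"
      using g by (auto simp: equivariant_maps_def PiE_iff)
    fix z assume z: "z \<in> states Z"
    then have "f (g z) = f (g' z)" using fun_cong[OF eq, of z] by (simp add: compose_def)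
    moreover have "g z \<in> states X" "g' z \<in> states X"
      using g z by (auto simp: equivariant_maps_def)
    ultimately show "g z = g' z" using inj by (simp add: inj_on_eq_iff)
  qed
qed

lemma inj_on_if_monomorphism:
  assumes small: "\<And>r. r \<in> F_of_states \<Sigma> \<Longrightarrow> \<exists>h. kernel_is \<Sigma> h r \<and> h ` lists \<Sigma> \<in> \<U>"
    and X: "X \<in> Ob (SSet_of \<U> \<Sigma>)" and m: "monomorphism (SSet_of \<U> \<Sigma>) X Y m"
  shows "inj_on m (states X)"
proof (rule inj_onI)
  fix p q assume p: "p \<in> states X" and q: "q \<in> states X" and eq: "m p = m q"
  have sset: "is_sset \<Sigma> X" and of: "orbitwise_finite \<Sigma> X" using X by (auto simp: Ob_SSet_of)
  have mXY: "m \<in> equivariant_maps \<Sigma> X Y" using m by (simp add: monomorphism_def)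
  \<comment> \<open>This is the largest relation contained in both kernels, so the generator of its
    cyclic object can be sent to \<open>p\<close> as well as to \<open>q\<close>.\<close>
  let ?r = "xi \<Sigma> X p \<inter> xi \<Sigma> X q"
  have r: "?r \<in> F_of_states \<Sigma>"
  proof -
    note pF = xi_in_F_of_states[OF sset of p] and qF = xi_in_F_of_states[OF sset of q]
    have "equiv (lists \<Sigma>) ?r"
      using F_of_states_equiv[OF pF] F_of_states_equiv[OF qF]
      by (auto simp: equiv_def refl_on_def sym_Int trans_Int simp del: in_lists_conv_set)
    then have "right_congruence \<Sigma> ?r"
      using F_of_states_append[OF pF] F_of_states_append[OF qF]
      unfolding right_congruence_def by blast
    \<comment> \<open>A class of the intersection is the intersection of a class of each kernel, and
      there are finitely many such pairs.\<close>
    moreover have "lists \<Sigma> // ?r \<subseteq>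
        (\<lambda>(c, d). c \<inter> d) ` ((lists \<Sigma> // xi \<Sigma> X p) \<times> (lists \<Sigma> // xi \<Sigma> X q))"
    proof
      fix c assume "c \<in> lists \<Sigma> // ?r"
      then obtain u where u: "u \<in> lists \<Sigma>" "c = ?r `` {u}" by (rule quotientE)
      then have "c = (\<lambda>(c, d). c \<inter> d) (xi \<Sigma> X p `` {u}, xi \<Sigma> X q `` {u})" by auto
      then show "c \<in> (\<lambda>(c, d). c \<inter> d) ` ((lists \<Sigma> // xi \<Sigma> X p) \<times> (lists \<Sigma> // xi \<Sigma> X q))"
        using quotientI[OF u(1)] by blast
    qed
    then have "finite (lists \<Sigma> // ?r)"
      by (rule finite_surj[rotated]) (use pF qF in \<open>auto simp: F_of_states_def\<close>)
    ultimately show ?thesis by (simp add: F_of_states_def)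
  qed
  obtain h where h: "kernel_is \<Sigma> h ?r" "h ` lists \<Sigma> \<in> \<U>" using small[OF r] by blast
  let ?Z = "cyclic_sset \<Sigma> h"
  have Z: "?Z \<in> Ob (SSet_of \<U> \<Sigma>)"
    using h(2) is_sset_cyclic orbitwise_finite_cyclic[OF r h(1)] by (auto simp: Ob_SSet_of)
  obtain f where f: "f \<in> equivariant_maps \<Sigma> ?Z X" "\<And>u. u \<in> lists \<Sigma> \<Longrightarrow> f (h u) = act X p u"
    using cyclic_map[OF r h(1) sset p] by blast
  obtain g where g: "g \<in> equivariant_maps \<Sigma> ?Z X" "\<And>u. u \<in> lists \<Sigma> \<Longrightarrow> g (h u) = act X q u"
    using cyclic_map[OF r h(1) sset q] by blast
  \<comment> \<open>Both composites with \<open>m\<close> are equivariant and send the generator to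
    \<open>m p = m q\<close>, so they agree on everything it reaches.\<close>
  have "m (f z) = m (g z)" if "z \<in> h ` lists \<Sigma>" for z
  proof -
    obtain u where u: "u \<in> lists \<Sigma>" "z = h u" using \<open>z \<in> h ` lists \<Sigma>\<close> by blast
    have "m (act X p u) = act Y (m p) u" "m (act X q u) = act Y (m q) u"
      using mXY p q u(1) unfolding equivariant_maps_def by blast+
    then show ?thesis using f(2) g(2) u eq by simp
  qed
  then have "compose (states ?Z) m f = compose (states ?Z) m g"
    by (auto simp: compose_def fun_eq_iff simp del: in_lists_conv_set)
  then have "f = g" using m f(1) g(1) Z by (auto simp: monomorphism_def)
  then show "p = q" using f(2)[of "[]"] g(2)[of "[]"] by simp
qed

text \<open>The map from the cyclic object sending the generator to \<open>q\<close> is injective,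
  since \<open>h\<close> and the action on \<open>q\<close> have the same kernel \<open>r\<close>.
  The cocone condition along this monomorphism moves the value at \<open>q\<close> to the
  generator.\<close>

lemma mono_cocone_cyclic:
  assumes cocone: "mono_cocone (SSet_of \<U> \<Sigma>) L \<phi>"
    and r: "r \<in> F_of_states \<Sigma>" and h: "kernel_is \<Sigma> h r" "h ` lists \<Sigma> \<in> \<U>"
    and X: "X \<in> Ob (SSet_of \<U> \<Sigma>)" and q: "q \<in> states X" and xi: "xi \<Sigma> X q = r"
  shows "\<phi> X q = \<phi> (cyclic_sset \<Sigma> h) (h [])"
proof -
  let ?Z = "cyclic_sset \<Sigma> h"
  have Z: "?Z \<in> Ob (SSet_of \<U> \<Sigma>)"
    using h(2) is_sset_cyclic orbitwise_finite_cyclic[OF r h(1)] by (auto simp: Ob_SSet_of)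
  have sset: "is_sset \<Sigma> X" using X by (simp add: Ob_SSet_of)
  obtain f where f: "f \<in> equivariant_maps \<Sigma> ?Z X" "\<And>u. u \<in> lists \<Sigma> \<Longrightarrow> f (h u) = act X q u"
    using cyclic_map[OF r h(1) sset q] xi by blast
  have "h u = h v" if "u \<in> lists \<Sigma>" "v \<in> lists \<Sigma>" "f (h u) = f (h v)" for u v
  proof -
    have "(u, v) \<in> xi \<Sigma> X q" using f(2) that q by (simp add: xi_apply)
    then show ?thesis using h(1) that(1,2) xi unfolding kernel_is_def by blast
  qed
  then have "inj_on f (states ?Z)" by (auto intro!: inj_onI simp del: in_lists_conv_set)
  then have "monomorphism (SSet_of \<U> \<Sigma>) ?Z X f" by (rule monomorphism_if_inj_on[OF f(1)])
  then have "compose (states ?Z) (\<phi> X) f = \<phi> ?Z"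
    using cocone Z X unfolding mono_cocone_def Comp_SSet_of by blast
  then have "\<phi> ?Z (h []) = compose (states ?Z) (\<phi> X) f (h [])" by simp
  also have "\<dots> = \<phi> X (f (h []))" by (auto simp: compose_def intro!: imageI)
  also have "f (h []) = q" using f(2)[of "[]"] by simp
  finally show ?thesis by simp
qed

text \<open>The hypothesis \<open>small\<close> enters through the injectivity of monomorphisms,
  which reduces the cocone condition to \<open>xi_injective_map\<close>.\<close>

lemma mono_cocone_xi:
  assumes small: "\<And>r. r \<in> F_of_states \<Sigma> \<Longrightarrow> \<exists>h. kernel_is \<Sigma> h r \<and> h ` lists \<Sigma> \<in> \<U>"
    and e: "inj_on e (F_of_states \<Sigma>)" "e ` F_of_states \<Sigma> \<in> \<U>"
  shows "mono_cocone (SSet_of \<U> \<Sigma>) (transport \<Sigma> e (F_of \<Sigma>))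
           (\<lambda>X. compose (states X) e (xi \<Sigma> X))"
  unfolding mono_cocone_def Hom_SSet_of Comp_SSet_of
proof (intro conjI ballI allI impI)
  have inj: "inj_on e (states (F_of \<Sigma>))" using e by simp
  show "transport \<Sigma> e (F_of \<Sigma>) \<in> Ob (SSet_of \<U> \<Sigma>)"
    using e(2) is_sset_transport[OF inj is_sset_F_of]
      orbitwise_finite_transport[OF inj is_sset_F_of orbitwise_finite_F_of]
    by (simp add: Ob_SSet_of)
next
  fix X :: "('b, 'a) sset" assume "X \<in> Ob (SSet_of \<U> \<Sigma>)"
  then have X: "is_sset \<Sigma> X" "orbitwise_finite \<Sigma> X" by (auto simp: Ob_SSet_of)
  have inj: "inj_on e (states (F_of \<Sigma>))" using e by simp
  let ?\<xi> = "compose (states X) e (xi \<Sigma> X)"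
  have "?\<xi> (act X q w) = act (transport \<Sigma> e (F_of \<Sigma>)) (?\<xi> q) w"
    if q: "q \<in> states X" and w: "w \<in> lists \<Sigma>" for q w
  proof -
    have F: "xi \<Sigma> X q \<in> F_of_states \<Sigma>" by (rule xi_in_F_of_states[OF X q])
    have "?\<xi> (act X q w) = e (congruence_act \<Sigma> (xi \<Sigma> X q) w)"
      using act_in_states[OF X(1) w q] xi_act[OF X(1) q w] by (simp add: compose_def)
    also have "\<dots> = act (transport \<Sigma> e (F_of \<Sigma>)) (e (xi \<Sigma> X q)) w"
      using act_transport[OF inj is_sset_F_of _ w] act_F_of[OF F w] F by simp
    finally show ?thesis using q by (simp add: compose_def)
  qed
  then show "?\<xi> \<in> equivariant_maps \<Sigma> X (transport \<Sigma> e (F_of \<Sigma>))"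
    using xi_in_F_of_states[OF X]
    by (auto simp: equivariant_maps_def compose_def simp del: in_lists_conv_set)
next
  fix X Y :: "('b, 'a) sset" and m
  assume X: "X \<in> Ob (SSet_of \<U> \<Sigma>)" and m: "monomorphism (SSet_of \<U> \<Sigma>) X Y m"
  have mXY: "m \<in> equivariant_maps \<Sigma> X Y" using m by (simp add: monomorphism_def)
  have "xi \<Sigma> Y (m q) = xi \<Sigma> X q" if "q \<in> states X" for q
    using xi_injective_map[OF mXY inj_on_if_monomorphism[OF small X m] _ that] X
    by (simp add: Ob_SSet_of)
  moreover have "m q \<in> states Y" if "q \<in> states X" for q
    using mXY that by (auto simp: equivariant_maps_def)
  ultimately show "compose (states X) (compose (states Y) e (xi \<Sigma> Y)) m = compose (states X) e (xi \<Sigma> X)"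
    by (auto simp: compose_def fun_eq_iff)
qed

text \<open>Right congruences live in \<open>'s list rel\<close>, whereas objects of the category
  are carried by subsets of \<open>'u\<close>. The classifier is therefore the copy of
  \<open>F_of \<Sigma>\<close> along \<open>e\<close>, and each \<open>xi\<close> is followed by
  \<open>e\<close>.\<close>

theorem corollary6p2:
  fixes \<Sigma> :: "'s set"
    and \<U> :: "'u set set"
    and e :: "'s list rel \<Rightarrow> 'u"
  assumes subsets_small: "\<And>A B. B \<in> \<U> \<Longrightarrow> A \<subseteq> B \<Longrightarrow> A \<in> \<U>"
    and F_of_small: "inj_on e (states (F_of \<Sigma>))" "e ` states (F_of \<Sigma>) \<in> \<U>"
  shows "local_state_classifier (SSet_of \<U> \<Sigma>)
           (transport \<Sigma> e (F_of \<Sigma>))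
           (\<lambda>X. compose (states X) e (xi \<Sigma> X))"
proof -
  let ?C = "SSet_of \<U> \<Sigma>"
  let ?F = "transport \<Sigma> e (F_of \<Sigma>)"
  let ?S = "F_of_states \<Sigma>"
  have e: "inj_on e ?S" "e ` ?S \<in> \<U>" using F_of_small by simp_all
  have small: "\<exists>h. kernel_is \<Sigma> h r \<and> h ` lists \<Sigma> \<in> \<U>" if "r \<in> ?S" for r
    by (rule small_kernel_map[OF _ e that]) (use subsets_small in blast)+
  then obtain h where h: "\<And>r. r \<in> ?S \<Longrightarrow> kernel_is \<Sigma> (h r) r"
      "\<And>r. r \<in> ?S \<Longrightarrow> h r ` lists \<Sigma> \<in> \<U>"
    by metis
  let ?Z = "\<lambda>r. cyclic_sset \<Sigma> (h r)"
  let ?z = "\<lambda>r. h r []"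
  have Z: "?Z r \<in> Ob ?C" if "r \<in> ?S" for r
    using h that is_sset_cyclic orbitwise_finite_cyclic[OF that h(1)[OF that]]
    by (auto simp: Ob_SSet_of)
  have z: "?z r \<in> states (?Z r)" for r by (auto intro!: imageI)
  have xi_z: "xi \<Sigma> (?Z r) (?z r) = r" if "r \<in> ?S" for r by (rule xi_cyclic[OF that h(1)[OF that]])
  have "\<exists>!u. u \<in> Hom ?C ?F L \<and>
      (\<forall>X\<in>Ob ?C. Comp ?C X ?F L u (compose (states X) e (xi \<Sigma> X)) = \<phi> X)"
    if cocone: "mono_cocone ?C L \<phi>" for L \<phi>
    unfolding Hom_SSet_of Comp_SSet_of
  proof (rule ex1I conjI)+
    \<comment> \<open>The only possible choice: \<open>e r\<close> is the image of the generator of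
      \<open>?Z r\<close> under the cocone.\<close>
    let ?u = "\<lambda>x\<in>e ` ?S. (\<lambda>r. \<phi> (?Z r) (?z r)) (the_inv_into ?S e x)"
    have u: "?u (e r) = \<phi> (?Z r) (?z r)" if "r \<in> ?S" for r
      using that by (simp add: the_inv_into_f_f[OF e(1)])
    have \<phi>: "\<phi> X \<in> equivariant_maps \<Sigma> X L" if "X \<in> Ob ?C" for X
      using cocone that by (simp add: mono_cocone_def)
    have \<phi>_eq: "\<phi> X q = \<phi> (?Z (xi \<Sigma> X q)) (?z (xi \<Sigma> X q))"
      if X: "X \<in> Ob ?C" and q: "q \<in> states X" for X q
    proof -
      have F: "xi \<Sigma> X q \<in> ?S" by (rule xi_in_F_of_states) (use X q in \<open>auto simp: Ob_SSet_of\<close>)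
      show ?thesis by (rule mono_cocone_cyclic[OF cocone F h(1)[OF F] h(2)[OF F] X q refl])
    qed
    have "?u (act ?F (e r) w) = act L (?u (e r)) w" if r: "r \<in> ?S" and w: "w \<in> lists \<Sigma>" for r w
    proof -
      \<comment> \<open>This state of \<open>?Z r\<close> has the translate of \<open>r\<close> by
        \<open>w\<close> as its kernel. Hence \<open>\<phi>_eq\<close> compares it with the
        generator of the cyclic object for the translate, and equivariance of \<open>?u\<close>
        follows from that of \<open>\<phi> (?Z r)\<close>.\<close>
      let ?q = "act (?Z r) (?z r) w"
      have q: "?q \<in> states (?Z r)" by (rule act_in_states[OF is_sset_cyclic w z])
      have "act ?F (e r) w = e (congruence_act \<Sigma> r w)"
        using act_transport[OF F_of_small(1) is_sset_F_of _ w] act_F_of[OF r w] r by simp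
      then have "?u (act ?F (e r) w) =
          \<phi> (?Z (congruence_act \<Sigma> r w)) (?z (congruence_act \<Sigma> r w))"
        using u[OF congruence_act_in_F_of_states[OF r w]] by simp
      also have "congruence_act \<Sigma> r w = xi \<Sigma> (?Z r) ?q"
        using xi_act[OF is_sset_cyclic z w] xi_z[OF r] by simp
      also have "\<phi> (?Z (xi \<Sigma> (?Z r) ?q)) (?z (xi \<Sigma> (?Z r) ?q)) = \<phi> (?Z r) ?q"
        using \<phi>_eq[OF Z[OF r] q] by simp
      also have "\<dots> = act L (\<phi> (?Z r) (?z r)) w"
        using \<phi>[OF Z[OF r]] z w unfolding equivariant_maps_def by blast
      finally show ?thesis using u[OF r] by simp
    qed
    moreover have "?u (e r) \<in> states L" if "r \<in> ?S" for r
      unfolding u[OF that] using \<phi>[OF Z[OF that]] z[of r] unfolding equivariant_maps_def by blast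
    then have "?u \<in> e ` ?S \<rightarrow>\<^sub>E states L" by (intro PiE_I) force+
    ultimately show "?u \<in> equivariant_maps \<Sigma> ?F L"
      unfolding equivariant_maps_def states_transport states_F_of by blast
    show "\<forall>X\<in>Ob ?C. compose (states X) ?u (compose (states X) e (xi \<Sigma> X)) = \<phi> X"
    proof
      fix X assume X: "X \<in> Ob ?C"
      show "compose (states X) ?u (compose (states X) e (xi \<Sigma> X)) = \<phi> X"
      proof (rule extensionalityI)
        show "\<phi> X \<in> extensional (states X)"
          using \<phi>[OF X] by (simp add: equivariant_maps_def PiE_iff)
        fix q assume q: "q \<in> states X"
        have "xi \<Sigma> X q \<in> ?S"
          by (rule xi_in_F_of_states) (use X q in \<open>auto simp: Ob_SSet_of\<close>)
        then show "compose (states X) ?u (compose (states X) e (xi \<Sigma> X)) q = \<phi> X q"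
          using u \<phi>_eq[OF X q] q by (simp add: compose_eq)
      qed simp
    qed
    fix v assume v: "v \<in> equivariant_maps \<Sigma> ?F L \<and>
      (\<forall>X\<in>Ob ?C. compose (states X) v (compose (states X) e (xi \<Sigma> X)) = \<phi> X)"
    show "v = ?u"
    proof (rule extensionalityI)
      show "v \<in> extensional (e ` ?S)" using v by (simp add: equivariant_maps_def PiE_iff)
      show "?u \<in> extensional (e ` ?S)" by simp
      fix x assume "x \<in> e ` ?S"
      then obtain r where r: "r \<in> ?S" "x = e r" by blast
      \<comment> \<open>Evaluating the factorisation at the generator of \<open>?Z r\<close> fixes
        \<open>v\<close> at \<open>e r\<close>.\<close>
      have "compose (states (?Z r)) v (compose (states (?Z r)) e (xi \<Sigma> (?Z r))) = \<phi> (?Z r)"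
        using v Z[OF r(1)] by blast
      then have "v (e (xi \<Sigma> (?Z r) (?z r))) = \<phi> (?Z r) (?z r)"
        using z[of r] by (metis compose_eq)
      then show "v x = ?u x" using u r xi_z by simp
    qed
  qed
  then show ?thesis
    using mono_cocone_xi[OF small e] unfolding local_state_classifier_def by blast
qed

end
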